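(* For every integer $d>3$ there is a constant $c_d>0$ such that the following holds for every prime $p$. Let $\vec{t}=(t_1,\dots,t_{d-1})\in\{1,\dots,p-1\}^{d-1}$, and let $S_{\vec{t}}$ denote the collection of the $2^{d-1}$ partially ordered sets, one for each choice of signs $(\varepsilon_1,\dots,\varepsilon_{d-1})\in\{1,-1\}^{d-1}$, of the form $$\big\{\big((\varepsilon_1 t_1 k)\bmod p,\ \dots,\ (\varepsilon_{d-1}t_{d-1}k)\bmod p,\ k\big)\ \big|\ 0\le k<p\big\}$$ under the product order. Then for each such $\vec{t}$ there exists an element of $S_{\vec{t}}$ whose width is at least $c_d\,p^{1-\frac1d}$.
   Context: For an integer $m$, $m \bmod p$ denotes the representative of $m$ modulo $p$ in $\{0,1,\dots,p-1\}$; the parameter $k$ ranges over integers. The product order on $d$-tuples is $x\le y$ iff $x_i\le y_i$ for all $i$. The width of a finite poset is the size of its largest antichain. *)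

theory Defs
  imports Complex_Main "HOL-Library.FuncSet" "HOL-Computational_Algebra.Primes"
begin

definition antichain :: "'a::order set \<Rightarrow> bool" where
  "antichain A \<longleftrightarrow> (\<forall>x\<in>A. \<forall>y\<in>A. x \<le> y \<longrightarrow> x = y)"

text \<open>Meaningful for finite \<open>P\<close> only.\<close>
definition width :: "'a::order set \<Rightarrow> nat" where
  "width P = Max (card ` {A. A \<subseteq> P \<and> antichain A})"

text \<open>
  A \<open>d\<close>-tuple of integers is a function in \<open>{1..d} \<rightarrow>\<^sub>E UNIV\<close>. Such functions all take the same
  value outside \<open>{1..d}\<close>, so the library's pointwise order on \<open>nat \<Rightarrow> int\<close> restricts to the product
  order on \<open>d\<close>-tuples. As \<open>p > 0\<close>, \<open>mod\<close> on \<open>int\<close> yields representatives in \<open>{0..p - 1}\<close>, also for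
  negative arguments.
\<close>
definition lattice_point ::
    "nat \<Rightarrow> nat \<Rightarrow> (nat \<Rightarrow> int) \<Rightarrow> (nat \<Rightarrow> int) \<Rightarrow> int \<Rightarrow> (nat \<Rightarrow> int)" where
  "lattice_point d p t \<epsilon> k =
     (\<lambda>i\<in>{1..d}. if i = d then k else (\<epsilon> i * t i * k) mod int p)"

definition signed_poset ::
    "nat \<Rightarrow> nat \<Rightarrow> (nat \<Rightarrow> int) \<Rightarrow> (nat \<Rightarrow> int) \<Rightarrow> (nat \<Rightarrow> int) set" where
  "signed_poset d p t \<epsilon> = {lattice_point d p t \<epsilon> k |k. 0 \<le> k \<and> k < int p}"

definition signed_posets :: "nat \<Rightarrow> nat \<Rightarrow> (nat \<Rightarrow> int) \<Rightarrow> (nat \<Rightarrow> int) set set" where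
  "signed_posets d p t = signed_poset d p t ` ({1..d - 1} \<rightarrow>\<^sub>E {1, -1})"

end

theory Submission
  imports Defs
begin

text \<open>
  By pigeonhole there is a nonzero integer vector \<open>u\<close> with entries of size at most \<open>p\<^bsup>1/d\<^esup>\<close> and
  \<open>u\<^sub>1 t\<^sub>1 + \<dots> + u\<^bsub>d-1\<^esub> t\<^bsub>d-1\<^esub> + u\<^sub>d \<equiv> 0\<close> modulo \<open>p\<close>, where \<open>u\<^sub>d \<ge> 0\<close>. Taking for \<open>\<epsilon>\<^sub>i\<close> the sign of
  \<open>u\<^sub>i\<close>, the functional \<open>f(x) = \<Sum> \<bar>u\<^sub>i\<bar> x\<^sub>i\<close> is monotone and takes values divisible by \<open>p\<close> on the poset.
  Its level sets are antichains: if \<open>x \<le> y\<close> and \<open>f(x) = f(y)\<close>, then \<open>x\<close> and \<open>y\<close> agree in a coordinate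
  with \<open>u\<^sub>i \<noteq> 0\<close>, and each coordinate determines \<open>k\<close> because \<open>p\<close> is prime. There are at most
  \<open>\<Sum> \<bar>u\<^sub>i\<bar> \<le> d p\<^bsup>1/d\<^esup>\<close> levels for \<open>p\<close> points.
\<close>

text \<open>There are more vectors with entries in \<open>{0..B}\<close> than residues modulo
  \<open>m\<close>, so two of them share a residue; their difference has entries of absolute value
  at most \<open>B\<close>.\<close>

lemma small_solution_of_linear_congruence:
  fixes a :: "'i \<Rightarrow> int" and m B :: nat
  assumes I: "finite I" and m: "m > 0" "m < (B + 1) ^ card I"
  shows "\<exists>u. (\<exists>i\<in>I. u i \<noteq> 0) \<and> (\<forall>i\<in>I. \<bar>u i\<bar> \<le> int B) \<and> int m dvd (\<Sum>i\<in>I. u i * a i)"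
proof -
  define V where "V = (I \<rightarrow>\<^sub>E {0..int B})"
  define h where "h v = (\<Sum>i\<in>I. v i * a i) mod int m" for v
  have cardV: "card V = (B + 1) ^ card I"
    unfolding V_def using I by (simp add: card_PiE nat_add_distrib)
  have "h ` V \<subseteq> {0..<int m}"
    using m by (auto simp: h_def)
  then have "card (h ` V) \<le> card {0..<int m}"
    by (intro card_mono) auto
  then have "card (h ` V) < card V"
    using cardV m by simp
  then have "\<not> inj_on h V"
    by (rule pigeonhole)
  then obtain v w where vw: "v \<in> V" "w \<in> V" "h v = h w" "v \<noteq> w"
    by (auto simp: inj_on_def)
  show ?thesis
  proof (intro exI[of _ "\<lambda>i. v i - w i"] conjI)
    show "\<exists>i\<in>I. v i - w i \<noteq> 0"
      using vw PiE_ext[of v I "\<lambda>_. {0..int B}" w] by (auto simp: V_def)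
    show "\<forall>i\<in>I. \<bar>v i - w i\<bar> \<le> int B"
    proof
      fix i assume "i \<in> I"
      then have "v i \<in> {0..int B}" "w i \<in> {0..int B}"
        using vw by (auto simp: V_def)
      then show "\<bar>v i - w i\<bar> \<le> int B"
        by auto
    qed
    show "int m dvd (\<Sum>i\<in>I. (v i - w i) * a i)"
      using vw(3) by (simp add: h_def mod_eq_dvd_iff left_diff_distrib sum_subtractf)
  qed
qed

lemma card_antichain_le_width:
  assumes "finite P" "A \<subseteq> P" "antichain A"
  shows "card A \<le> width P"
  unfolding width_def using assms by (intro Max_ge) auto

text \<open>For \<open>i < d\<close> the coordinate is multiplication modulo \<open>p\<close> by
  \<open>\<epsilon> i * t i\<close>, a unit because \<open>p\<close> is prime and
  \<open>0 < t i < p\<close>; for \<open>i = d\<close> it is \<open>k\<close> itself.\<close>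

lemma lattice_point_coordinate_inj:
  assumes p: "prime p" and t: "\<And>i. i \<in> {1..d - 1} \<Longrightarrow> t i \<in> {1..int p - 1}"
    and e: "\<And>i. i \<in> {1..d - 1} \<Longrightarrow> \<epsilon> i \<in> {1, -1}" and i: "i \<in> {1..d}"
    and k: "k \<in> {0..<int p}" and l: "l \<in> {0..<int p}"
    and eq: "lattice_point d p t \<epsilon> k i = lattice_point d p t \<epsilon> l i"
  shows "k = l"
proof (cases "i = d")
  case True
  then show ?thesis using eq i by (simp add: lattice_point_def)
next
  case False
  then have i': "i \<in> {1..d - 1}" using i by auto
  have "int p dvd \<epsilon> i * t i * k - \<epsilon> i * t i * l"
    using eq False i by (simp add: lattice_point_def mod_eq_dvd_iff)
  then have "int p dvd \<epsilon> i * (t i * (k - l))"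
    by (simp add: algebra_simps)
  then have "int p dvd t i * (k - l)"
    using e[OF i'] by auto
  moreover have "\<not> int p dvd t i"
    using t[OF i'] by (auto dest: zdvd_imp_le)
  ultimately have "int p dvd k - l"
    using p by (simp add: prime_dvd_mult_iff)
  then show ?thesis
    using k l by (metis atLeastLessThan_iff mod_eq_dvd_iff mod_pos_pos_trivial)
qed

text \<open>The signs of the congruence sit in \<open>\<epsilon>\<close>, which leaves nonnegative
  weights \<open>u\<close>. The inequality comes from counting the \<open>p\<close> points level by
  level.\<close>

lemma width_signed_poset_ge:
  fixes u :: "nat \<Rightarrow> int"
  assumes p: "prime p" and t: "\<And>i. i \<in> {1..d - 1} \<Longrightarrow> t i \<in> {1..int p - 1}"
    and e: "\<And>i. i \<in> {1..d - 1} \<Longrightarrow> \<epsilon> i \<in> {1, -1}"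
    and u: "\<And>i. i \<in> {1..d} \<Longrightarrow> u i \<ge> 0" "\<exists>i\<in>{1..d}. u i \<noteq> 0"
    and dvd: "int p dvd (\<Sum>i\<in>{1..d}. u i * (if i = d then 1 else \<epsilon> i * t i))"
  shows "real p \<le> real (width (signed_poset d p t \<epsilon>)) * real_of_int (\<Sum>i\<in>{1..d}. u i)"
proof -
  define x where "x = lattice_point d p t \<epsilon>"
  define f where "f k = (\<Sum>i\<in>{1..d}. u i * x k i)" for k
  define S where "S = (\<Sum>i\<in>{1..d}. u i)"
  define P where "P = signed_poset d p t \<epsilon>"
  define K where "K = {0..<int p}"
  have "S \<ge> 0"
    unfolding S_def using u(1) by (intro sum_nonneg) auto
  have p0: "p > 0" using p by (rule prime_gt_0_nat)
  have P_eq: "P = x ` K"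
    by (auto simp: P_def signed_poset_def x_def K_def)
  have inj: "k = l" if "k \<in> K" "l \<in> K" "i \<in> {1..d}" "x k i = x l i" for k l i
    using lattice_point_coordinate_inj[OF p t e] that by (simp add: x_def K_def)
  obtain i0 where i0: "i0 \<in> {1..d}" "u i0 > 0"
    using u by (metis order_le_less)
  have x_range: "0 \<le> x k i" "x k i < int p" if "k \<in> K" "i \<in> {1..d}" for k i
    using that p0 by (auto simp: x_def K_def lattice_point_def)
  \<comment> \<open>Reducing a coordinate modulo \<open>p\<close> changes \<open>f k\<close> by a
    multiple of \<open>p\<close>, and the last coordinate \<open>k\<close> is already reduced. What
    remains is the sum in \<open>dvd\<close> times \<open>k\<close>.\<close>
  have f_dvd: "int p dvd f k" if k: "k \<in> K" for k
  proof -
    let ?T = "\<lambda>i. if i = d then 1 else \<epsilon> i * t i"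
    have "f k mod int p = (\<Sum>i\<in>{1..d}. u i * ((?T i * k) mod int p)) mod int p"
      using k unfolding f_def x_def K_def
      by (intro arg_cong2[where f = "(mod)"] sum.cong refl) (simp add: lattice_point_def)
    also have "\<dots> = (\<Sum>i\<in>{1..d}. u i * (?T i * k)) mod int p"
      by (subst (1 2) mod_sum_eq[symmetric]) (simp only: mod_mult_right_eq)
    also have "(\<Sum>i\<in>{1..d}. u i * (?T i * k)) = (\<Sum>i\<in>{1..d}. u i * ?T i) * k"
      by (simp only: sum_distrib_right mult.assoc)
    also have "\<dots> mod int p = 0"
      using dvd by simp
    finally show ?thesis by auto
  qed
  have level: "f k div int p \<in> {0..<S}" if k: "k \<in> K" for k
  proof -
    have "0 \<le> f k"
      unfolding f_def using u(1) x_range[OF k] by (intro sum_nonneg mult_nonneg_nonneg) auto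
    \<comment> \<open>Strict because coordinates stay below \<open>p\<close> and
      \<open>u i0 > 0\<close>. Hence the possible levels are 0 to \<open>S - 1\<close>, so
      \<open>S\<close> of them and not \<open>S + 1\<close>.\<close>
    moreover have "f k < (\<Sum>i\<in>{1..d}. u i * int p)"
      unfolding f_def
    proof (rule sum_strict_mono_ex1)
      show "\<forall>i\<in>{1..d}. u i * x k i \<le> u i * int p"
        using u(1) by (intro ballI mult_left_mono less_imp_le[OF x_range(2)[OF k]])
      show "\<exists>i\<in>{1..d}. u i * x k i < u i * int p"
        using i0 x_range[OF k] by (intro bexI[of _ i0] mult_strict_left_mono) auto
    qed simp
    then have "f k < S * int p"
      by (simp add: S_def sum_distrib_right)
    then have "f k div int p * int p < S * int p"
      using f_dvd[OF k] by simp
    then have "f k div int p < S"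
      by (rule mult_right_less_imp_less) simp
    ultimately show ?thesis
      using p0 by (simp add: pos_imp_zdiv_nonneg_iff)
  qed
  have anti: "card {k \<in> K. f k div int p = m} \<le> width P" for m
  proof -
    let ?L = "{k \<in> K. f k div int p = m}"
    have "antichain (x ` ?L)"
      unfolding antichain_def
    proof (intro ballI impI)
      fix y z assume "y \<in> x ` ?L" "z \<in> x ` ?L" and le: "y \<le> z"
      then obtain k l where kl: "k \<in> K" "l \<in> K" "y = x k" "z = x l"
        and "f k div int p = m" "f l div int p = m" by auto
      \<comment> \<open>Both values are multiples of \<open>p\<close>, so equal quotients force
        equal values.\<close>
      then have "f k = f l"
        using f_dvd[of k] f_dvd[of l] by (metis dvd_div_mult_self)
      then have "(\<Sum>i\<in>{1..d}. u i * (x l i - x k i)) = 0"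
        by (simp add: f_def right_diff_distrib sum_subtractf)
      moreover have "\<forall>i\<in>{1..d}. 0 \<le> u i * (x l i - x k i)"
        using u(1) le kl by (auto simp: le_fun_def)
      \<comment> \<open>Nonnegative terms with sum zero all vanish; at \<open>i0\<close> the weight
        is positive, so the coordinates agree there.\<close>
      ultimately have "u i0 * (x l i0 - x k i0) = 0"
        using i0(1) sum_nonneg_eq_0_iff[of "{1..d}" "\<lambda>i. u i * (x l i - x k i)"] by simp
      then have "x k i0 = x l i0"
        using i0 by simp
      then show "y = z"
        using inj[OF kl(1,2) i0(1)] kl by simp
    qed
    then have "card (x ` ?L) \<le> width P"
      by (intro card_antichain_le_width) (auto simp: P_eq K_def)
    moreover have "inj_on x ?L"
      using inj[OF _ _ i0(1)] by (auto simp: inj_on_def)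
    ultimately show ?thesis
      by (simp add: card_image)
  qed
  have "K = (\<Union>m\<in>{0..<S}. {k \<in> K. f k div int p = m})"
    using level by auto
  then have "card K = card (\<Union>m\<in>{0..<S}. {k \<in> K. f k div int p = m})"
    by (rule arg_cong)
  also have "\<dots> \<le> (\<Sum>m\<in>{0..<S}. card {k \<in> K. f k div int p = m})"
    by (rule card_UN_le) simp
  also have "\<dots> \<le> (\<Sum>m\<in>{0..<S}. width P)"
    by (intro sum_mono anti)
  also have "\<dots> = nat S * width P"
    by simp
  finally have "p \<le> nat S * width P"
    by (simp add: K_def)
  then have "real p \<le> real (nat S * width P)"
    by (rule of_nat_mono)
  also have "\<dots> = real (width P) * real_of_int S"
    using \<open>S \<ge> 0\<close> by simp
  finally show ?thesis
    by (simp add: S_def P_def)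
qed

theorem theorem4p1:
  fixes d :: nat
  assumes "d > 3"
  shows "\<exists>c::real. c > 0 \<and>
    (\<forall>p::nat. prime p \<longrightarrow>
      (\<forall>t \<in> {1..d - 1} \<rightarrow>\<^sub>E {1..int p - 1}.
        \<exists>P \<in> signed_posets d p t.
          real (width P) \<ge> c * real p powr (1 - 1 / real d)))"
\<comment> \<open>The factor \<open>d\<close> counts the coordinates: the weights are
  \<open>d\<close> numbers of size at most \<open>r\<close>, so their sum is at most
  \<open>d * r\<close>.\<close>
proof (intro exI[of _ "1 / real d"] conjI allI impI ballI)
  show "1 / real d > 0" using assms by simp
next
  fix p :: nat and t :: "nat \<Rightarrow> int"
  assume p: "prime p" and t: "t \<in> {1..d - 1} \<rightarrow>\<^sub>E {1..int p - 1}"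
  have p0: "p > 0" using p by (rule prime_gt_0_nat)
  define r where "r = real p powr (1 / real d)"
  have r0: "r > 0" using p0 by (simp add: r_def)
  have rd: "r ^ d = real p"
    using p0 assms by (simp add: r_def powr_power)
  \<comment> \<open>Rounding down keeps the entries at most \<open>r\<close>, while
    \<open>B + 1 > r\<close> still gives the strict inequality \<open>p < (B + 1) ^ d\<close> for
    the pigeonhole.\<close>
  define B where "B = nat \<lfloor>r\<rfloor>"
  have B: "real B \<le> r" "r < real (B + 1)"
    using r0 by (simp_all add: B_def) linarith
  have "real p < real (B + 1) ^ d"
    unfolding rd[symmetric] using B r0 assms by (intro power_strict_mono) auto
  then have "p < (B + 1) ^ d"
    by (metis of_nat_less_iff of_nat_power)
  then obtain v where v: "\<exists>i\<in>{1..d}. v i \<noteq> 0" "\<forall>i\<in>{1..d}. \<bar>v i\<bar> \<le> int B"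
    "int p dvd (\<Sum>i\<in>{1..d}. v i * (if i = d then 1 else t i))"
    using small_solution_of_linear_congruence[of "{1..d}" p B "\<lambda>i. if i = d then 1 else t i"] p0
    by auto
  \<comment> \<open>The last coordinate has no sign to choose, so \<open>s\<close> negates the whole
    solution when \<open>v d\<close> is negative. Then \<open>s * v d = \<bar>v d\<bar>\<close>, and
    \<open>s * v i = \<epsilon> i * \<bar>v i\<bar>\<close> for the other \<open>i\<close>; where
    \<open>v i = 0\<close> either sign would do.\<close>
  define s :: int where "s = (if v d < 0 then -1 else 1)"
  define \<epsilon> :: "nat \<Rightarrow> int" where "\<epsilon> = (\<lambda>i\<in>{1..d - 1}. if s * v i < 0 then -1 else 1)"
  have e: "\<epsilon> \<in> {1..d - 1} \<rightarrow>\<^sub>E {1, -1}"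
    by (auto simp: \<epsilon>_def)
  have "(\<Sum>i\<in>{1..d}. \<bar>v i\<bar> * (if i = d then 1 else \<epsilon> i * t i))
      = (\<Sum>i\<in>{1..d}. s * (v i * (if i = d then 1 else t i)))"
    by (intro sum.cong refl) (auto simp: \<epsilon>_def s_def)
  also have "\<dots> = s * (\<Sum>i\<in>{1..d}. v i * (if i = d then 1 else t i))"
    by (simp only: sum_distrib_left)
  finally have dvd: "int p dvd (\<Sum>i\<in>{1..d}. \<bar>v i\<bar> * (if i = d then 1 else \<epsilon> i * t i))"
    using v(3) by simp
  define w where "w = real (width (signed_poset d p t \<epsilon>))"
  have "real p \<le> w * real_of_int (\<Sum>i\<in>{1..d}. \<bar>v i\<bar>)"
    unfolding w_def by (rule width_signed_poset_ge[OF p _ _ _ _ dvd]) (use t e v(1) in auto)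
  also have "\<dots> \<le> w * (real d * r)"
  proof (rule mult_left_mono)
    have "(\<Sum>i\<in>{1..d}. \<bar>v i\<bar>) \<le> int d * int B"
      using sum_bounded_above[of "{1..d}" "\<lambda>i. \<bar>v i\<bar>" "int B"] v(2) by simp
    then have "real_of_int (\<Sum>i\<in>{1..d}. \<bar>v i\<bar>) \<le> real d * real B"
      by (metis of_int_le_iff of_int_mult of_int_of_nat_eq)
    also have "\<dots> \<le> real d * r"
      using B by (intro mult_left_mono) auto
    finally show "real_of_int (\<Sum>i\<in>{1..d}. \<bar>v i\<bar>) \<le> real d * r" .
  qed (simp add: w_def)
  finally have "real p / (real d * r) \<le> w"
    using r0 assms by (simp add: field_simps)
  moreover have "real p / (real d * r) = 1 / real d * real p powr (1 - 1 / real d)"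
    using p0 by (simp add: powr_diff r_def)
  ultimately show "\<exists>P \<in> signed_posets d p t.
      real (width P) \<ge> 1 / real d * real p powr (1 - 1 / real d)"
    using e by (auto simp: signed_posets_def w_def)
qed

end
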